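(* Let $A,B$ be positive operators on the weak-* sequentially complete anti-dual pair $\langle F,E\rangle$. The following conditions are equivalent: (i) $B$ is absolutely continuous with respect to $A$. (ii) $B$ is almost dominated by $A$, that is, there exist a monotone increasing sequence $(B_n)_{n\in\mathbb N}$ of positive operators in $\mathscr L(E;F)$ and a sequence $(\alpha_n)_{n\in\mathbb N}$ of positive numbers such that $B_n\le\alpha_nA$ for all $n$ and $B_n\to B$ pointwise on $E$.
   Context: An anti-dual pair $\langle F,E\rangle$ consists of complex vector spaces $E,F$ and a map $\langle\cdot,\cdot\rangle:F\times E\to\mathbb C$, linear in the first and conjugate linear in the second variable, that separates the points of $E$ and of $F$. $\sigma(F,E)$ is the weak topology on $F$ induced by the functionals $\langle\cdot,x\rangle$ ($x\in E$), and $\sigma(E,F)$ is the weak topology on $E$ induced by the functionals $\langle f,\cdot\rangle$ ($f\in F$). The pair is weak-* sequentially complete if every Cauchy sequence of $(F,\sigma(F,E))$ converges. $\mathscr L(E;F)$ is the set of $\sigma(E,F)$-$\sigma(F,E)$ continuous linear operators $E\to F$. A linear operator $A:E\to F$ is positive if $\langle Ax,x\rangle\ge0$ for all $x\in E$ (such operators belong to $\mathscr L(E;F)$ automatically); $A\le B$ means that $B-A$ is positive. Pointwise convergence $B_n\to B$ means $\langle B_nx,y\rangle\to\langle Bx,y\rangle$ for all $x,y\in E$. $B$ is absolutely continuous with respect to $A$ if for every sequence $(x_n)$ in $E$, $\langle Ax_n,x_n\rangle\to0$ and $\langle B(x_n-x_m),x_n-x_m\rangle\to0$ ($n,m\to\infty$)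 imply $\langle Bx_n,x_n\rangle\to0$. *)

theory Defs
  imports "HOL-Analysis.Analysis"
begin

text \<open>The spaces \<open>E\<close> and \<open>F\<close> are types of class \<^class>\<open>ab_group_add\<close> with explicit complex scalar
  multiplications \<open>sE\<close> and \<open>sF\<close>; \<open>pr f x\<close> is the pairing of \<open>f\<close> in \<open>F\<close> with \<open>x\<close> in \<open>E\<close>.\<close>

locale anti_dual_pair =
  E: vector_space sE + F: vector_space sF
  for sE :: "complex \<Rightarrow> 'e::ab_group_add \<Rightarrow> 'e"
    and sF :: "complex \<Rightarrow> 'f::ab_group_add \<Rightarrow> 'f" +
  fixes pr :: "'f \<Rightarrow> 'e \<Rightarrow> complex"
  assumes pr_add_left: "pr (f + g) x = pr f x + pr g x"
    and pr_scale_left: "pr (sF c f) x = c * pr f x"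
    and pr_add_right: "pr f (x + y) = pr f x + pr f y"
    and pr_scale_right: "pr f (sE c x) = cnj c * pr f x"
    and separates_E: "x \<noteq> y \<Longrightarrow> \<exists>f. pr f x \<noteq> pr f y"
    and separates_F: "f \<noteq> g \<Longrightarrow> \<exists>x. pr f x \<noteq> pr g x"

definition weak_topology :: "('a \<Rightarrow> complex) set \<Rightarrow> 'a topology" where
  "weak_topology \<Phi> = topology_generated_by {\<phi> -` U | \<phi> U. \<phi> \<in> \<Phi> \<and> open U}"

definition sigma_FE :: "('f \<Rightarrow> 'e \<Rightarrow> complex) \<Rightarrow> 'f topology" where
  "sigma_FE pr = weak_topology (range (\<lambda>x f. pr f x))"

definition sigma_EF :: "('f \<Rightarrow> 'e \<Rightarrow> complex) \<Rightarrow> 'e topology" where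
  "sigma_EF pr = weak_topology (range (\<lambda>f x. pr f x))"

text \<open>Cauchy sequences with respect to the translation-invariant uniformity of a group topology.\<close>

definition Cauchy_seq_in :: "'a::group_add topology \<Rightarrow> (nat \<Rightarrow> 'a) \<Rightarrow> bool" where
  "Cauchy_seq_in T s \<longleftrightarrow>
     (\<forall>U. openin T U \<and> 0 \<in> U \<longrightarrow> (\<exists>N. \<forall>m\<ge>N. \<forall>n\<ge>N. s m - s n \<in> U))"

definition weak_star_seq_complete :: "('f::group_add \<Rightarrow> 'e \<Rightarrow> complex) \<Rightarrow> bool" where
  "weak_star_seq_complete pr \<longleftrightarrow>
     (\<forall>s. Cauchy_seq_in (sigma_FE pr) s \<longrightarrow> (\<exists>l. limitin (sigma_FE pr) s l sequentially))"

definition weakly_continuous_operators ::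
  "(complex \<Rightarrow> 'e::ab_group_add \<Rightarrow> 'e) \<Rightarrow> (complex \<Rightarrow> 'f::ab_group_add \<Rightarrow> 'f) \<Rightarrow>
   ('f \<Rightarrow> 'e \<Rightarrow> complex) \<Rightarrow> ('e \<Rightarrow> 'f) set" where
  "weakly_continuous_operators sE sF pr =
     {A. Vector_Spaces.linear sE sF A \<and> continuous_map (sigma_EF pr) (sigma_FE pr) A}"

definition positive_operator ::
  "(complex \<Rightarrow> 'e::ab_group_add \<Rightarrow> 'e) \<Rightarrow> (complex \<Rightarrow> 'f::ab_group_add \<Rightarrow> 'f) \<Rightarrow>
   ('f \<Rightarrow> 'e \<Rightarrow> complex) \<Rightarrow> ('e \<Rightarrow> 'f) \<Rightarrow> bool" where
  "positive_operator sE sF pr A \<longleftrightarrow>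
     Vector_Spaces.linear sE sF A \<and> (\<forall>x. pr (A x) x \<in> \<real>\<^sub>\<ge>\<^sub>0)"

definition operator_le ::
  "(complex \<Rightarrow> 'e::ab_group_add \<Rightarrow> 'e) \<Rightarrow> (complex \<Rightarrow> 'f::ab_group_add \<Rightarrow> 'f) \<Rightarrow>
   ('f \<Rightarrow> 'e \<Rightarrow> complex) \<Rightarrow> ('e \<Rightarrow> 'f) \<Rightarrow> ('e \<Rightarrow> 'f) \<Rightarrow> bool" where
  "operator_le sE sF pr A B \<longleftrightarrow> positive_operator sE sF pr (\<lambda>x. B x - A x)"

definition pointwise_converges ::
  "('f \<Rightarrow> 'e \<Rightarrow> complex) \<Rightarrow> (nat \<Rightarrow> 'e \<Rightarrow> 'f) \<Rightarrow> ('e \<Rightarrow> 'f) \<Rightarrow> bool" where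
  "pointwise_converges pr Bs B \<longleftrightarrow>
     (\<forall>x y. (\<lambda>n. pr (Bs n x) y) \<longlonglongrightarrow> pr (B x) y)"

definition absolutely_continuous_wrt ::
  "('f \<Rightarrow> 'e::ab_group_add \<Rightarrow> complex) \<Rightarrow> ('e \<Rightarrow> 'f) \<Rightarrow> ('e \<Rightarrow> 'f) \<Rightarrow> bool" where
  "absolutely_continuous_wrt pr B A \<longleftrightarrow>
     (\<forall>x :: nat \<Rightarrow> 'e.
        (\<lambda>n. pr (A (x n)) (x n)) \<longlonglongrightarrow> 0 \<longrightarrow>
        ((\<lambda>(n, m). pr (B (x n - x m)) (x n - x m)) \<longlongrightarrow> 0) (sequentially \<times>\<^sub>F sequentially) \<longrightarrow>
        (\<lambda>n. pr (B (x n)) (x n)) \<longlonglongrightarrow> 0)"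

definition almost_dominated ::
  "(complex \<Rightarrow> 'e::ab_group_add \<Rightarrow> 'e) \<Rightarrow> (complex \<Rightarrow> 'f::ab_group_add \<Rightarrow> 'f) \<Rightarrow>
   ('f \<Rightarrow> 'e \<Rightarrow> complex) \<Rightarrow> ('e \<Rightarrow> 'f) \<Rightarrow> ('e \<Rightarrow> 'f) \<Rightarrow> bool" where
  "almost_dominated sE sF pr B A \<longleftrightarrow>
     (\<exists>(Bs :: nat \<Rightarrow> 'e \<Rightarrow> 'f) (\<alpha> :: nat \<Rightarrow> real).
        (\<forall>n. Bs n \<in> weakly_continuous_operators sE sF pr \<and> positive_operator sE sF pr (Bs n)) \<and>
        (\<forall>m n. m \<le> n \<longrightarrow> operator_le sE sF pr (Bs m) (Bs n)) \<and>
        (\<forall>n. \<alpha> n > 0) \<and>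
        (\<forall>n. operator_le sE sF pr (Bs n) (\<lambda>x. sF (of_real (\<alpha> n)) (A x))) \<and>
        pointwise_converges pr Bs B)"

end

theory Submission
  imports Defs
begin

text \<open>
  Both directions work with the quadratic forms \<open>a\<close>, \<open>b\<close>, \<open>b\<^sub>n\<close> of the operators.

  If \<open>B\<close> is absolutely continuous, the approximating operators are the parallel sums
  \<open>B\<^sub>n = B : (n+1)A\<close>, whose forms are \<open>b\<^sub>n(x) = inf\<^sub>w (b(x - w) + (n+1) a(w))\<close>. They
  increase with \<open>n\<close> and are dominated by \<open>b\<close> and by \<open>(n+1) a\<close>. By the parallelogram law,
  near-minimizers \<open>y\<^sub>n\<close> of \<open>b\<^sub>n(x)\<close> form a \<open>b\<close>-Cauchy sequence with \<open>a(y\<^sub>n) \<rightarrow> 0\<close>; hence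
  \<open>b(y\<^sub>n) \<rightarrow> 0\<close> and \<open>b\<^sub>n(x) \<rightarrow> b(x)\<close>.

  Conversely, \<open>b\<^sub>n(x\<^sub>k) \<le> 2 b\<^sub>n(x\<^sub>l) + 2 b(x\<^sub>k - x\<^sub>l)\<close>. Letting first \<open>l\<close> and then \<open>n\<close> tend to
  infinity bounds \<open>b(x\<^sub>k)\<close> by the Cauchy tail.
\<close>

section \<open>Positive sesquilinear forms\<close>

locale positive_form = vector_space scale
  for scale :: "complex \<Rightarrow> 'a::ab_group_add \<Rightarrow> 'a" +
  fixes q :: "'a \<Rightarrow> 'a \<Rightarrow> complex"
  assumes add_left: "q (x + y) z = q x z + q y z"
    and scale_left: "q (scale c x) z = c * q x z"
    and add_right: "q x (y + z) = q x y + q x z"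
    and scale_right: "q x (scale c y) = cnj c * q x y"
    and nonneg: "q x x \<in> \<real>\<^sub>\<ge>\<^sub>0"
begin

section \<open>Seminorm identities and the Cauchy-Schwarz inequality\<close>

definition sq :: "'a \<Rightarrow> real" where "sq x = Re (q x x)"

text \<open>Cauchy for the seminorm \<open>sqrt (sq x)\<close>, which may vanish at nonzero vectors;
  the squared form avoids roots.\<close>

definition form_Cauchy :: "(nat \<Rightarrow> 'a) \<Rightarrow> bool" where
  "form_Cauchy y \<longleftrightarrow> (\<forall>e>0. \<exists>N. \<forall>j\<ge>N. \<forall>k\<ge>N. sq (y j - y k) < e)"

lemma diff_left: "q (x - y) z = q x z - q y z"
  using add_left[of "x - y" y z] by simp

lemma diff_right: "q x (y - z) = q x y - q x z"
  using add_right[of x "y - z" z] by simp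

lemma sq_nonneg [simp]: "0 \<le> sq x"
  using nonneg[of x] by (auto simp: sq_def nonneg_Reals_def)

lemma self_eq: "q x x = of_real (sq x)"
  using nonneg[of x] by (auto simp: sq_def nonneg_Reals_def)

text \<open>Polarization: since \<open>q\<close> is real on the diagonal, expanding at
  \<open>x + y\<close> fixes the imaginary part of \<open>q y x\<close>, and expanding at
  \<open>x + scale \<i> y\<close> fixes its real part.\<close>

lemma hermitian: "q y x = cnj (q x y)"
proof -
  have "Im (q (x + y) (x + y)) = 0" "Im (q x x) = 0" "Im (q y y) = 0"
    by (simp_all add: self_eq)
  then have im: "Im (q x y) + Im (q y x) = 0"
    by (simp add: add_left add_right)
  have "Im (q (x + scale \<i> y) (x + scale \<i> y)) = 0"
    by (simp add: self_eq)
  then have "Re (q y x) = Re (q x y)"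
    using \<open>Im (q x x) = 0\<close> \<open>Im (q y y) = 0\<close>
    by (simp add: add_left add_right scale_left scale_right)
  with im show ?thesis by (simp add: complex_eq_iff)
qed

lemma sq_scale: "sq (scale c x) = (cmod c)\<^sup>2 * sq x"
proof -
  have "q (scale c x) (scale c x) = (c * cnj c) * q x x"
    by (simp add: scale_left scale_right)
  also have "\<dots> = of_real ((cmod c)\<^sup>2 * sq x)"
    by (simp only: complex_norm_square[symmetric] self_eq of_real_mult)
  finally show ?thesis by (simp only: sq_def Re_complex_of_real)
qed

lemma sq_add: "sq (x + y) = sq x + 2 * Re (q x y) + sq y"
  using hermitian[of x y] by (simp add: sq_def add_left add_right)

lemma sq_diff: "sq (x - y) = sq x - 2 * Re (q x y) + sq y"
  using hermitian[of x y] by (simp add: sq_def diff_left diff_right)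

lemma parallelogram: "sq (x + y) + sq (x - y) = 2 * sq x + 2 * sq y"
  by (simp add: sq_add sq_diff)

lemma sq_add_le: "sq (x + y) \<le> 2 * sq x + 2 * sq y"
  using parallelogram[of x y] sq_nonneg[of "x - y"] by linarith

lemma sq_midpoint:
  "4 * sq (scale (1/2) (x + y)) = sq (x + y)"
  by (simp add: sq_scale power2_eq_square)

lemma Cauchy_Schwarz: "(cmod (q x y))\<^sup>2 \<le> sq x * sq y"
proof -
  let ?r = "q x y"
  \<comment> \<open>Expand \<open>sq\<close> at \<open>x - scale (t * q x y) y\<close>; the factor
    \<open>q x y\<close> in the scalar makes the cross term real.\<close>
  have key: "0 \<le> sq x - 2 * t * (cmod ?r)\<^sup>2 + t\<^sup>2 * (cmod ?r)\<^sup>2 * sq y" for t :: real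
  proof -
    have "q x (scale (of_real t * ?r) y) = of_real t * (?r * cnj ?r)"
      by (simp add: scale_right)
    also have "\<dots> = of_real (t * (cmod ?r)\<^sup>2)"
      by (simp only: complex_norm_square[symmetric] of_real_mult)
    finally have "Re (q x (scale (of_real t * ?r) y)) = t * (cmod ?r)\<^sup>2"
      by (simp only: Re_complex_of_real)
    then show ?thesis
      using sq_nonneg[of "x - scale (of_real t * ?r) y"]
      by (simp add: sq_diff sq_scale norm_mult power_mult_distrib del: sq_nonneg)
  qed
  show ?thesis
  proof (cases "sq y = 0")
    case True
    have "cmod ?r = 0"
    proof (rule ccontr)
      assume "cmod ?r \<noteq> 0"
      \<comment> \<open>For this \<open>t\<close> the right-hand side of \<open>key\<close> equals
        -1.\<close>
      then show False
        using key[of "(sq x + 1) / (2 * (cmod ?r)\<^sup>2)"] True by simp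
    qed
    then show ?thesis by simp
  next
    case False
    then have "0 < sq y" using sq_nonneg[of y] by linarith
    \<comment> \<open>The minimizer of the quadratic polynomial in \<open>t\<close>.\<close>
    then show ?thesis using key[of "1 / sq y"]
      by (simp add: field_simps power2_eq_square)
  qed
qed

section \<open>Null sequences and Cauchy sequences of a form\<close>

lemma tendsto_form_zero:
  assumes "(\<lambda>k. sq (u k)) \<longlonglongrightarrow> 0"
  shows "(\<lambda>k. q (u k) z) \<longlonglongrightarrow> 0"
proof -
  have "(\<lambda>k. sqrt (sq (u k) * sq z)) \<longlonglongrightarrow> sqrt (0 * sq z)"
    by (intro tendsto_intros assms)
  then have "(\<lambda>k. sqrt (sq (u k) * sq z)) \<longlonglongrightarrow> 0"
    by (simp only: mult_zero_left real_sqrt_zero)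
  moreover have "\<forall>\<^sub>F k in sequentially. cmod (q (u k) z) \<le> sqrt (sq (u k) * sq z)"
    by (intro always_eventually allI real_le_rsqrt Cauchy_Schwarz)
  ultimately show ?thesis by (rule Lim_null_comparison[rotated])
qed

lemma form_Cauchy_add:
  assumes "form_Cauchy x" "form_Cauchy y"
  shows "form_Cauchy (\<lambda>k. x k + y k)"
  unfolding form_Cauchy_def
proof (intro allI impI)
  fix e :: real assume "0 < e"
  then have "0 < e / 4" by simp
  with assms obtain N M where
    N: "\<forall>j\<ge>N. \<forall>k\<ge>N. sq (x j - x k) < e / 4" and M: "\<forall>j\<ge>M. \<forall>k\<ge>M. sq (y j - y k) < e / 4"
    unfolding form_Cauchy_def by metis
  have "sq (x j + y j - (x k + y k)) < e" if "j \<ge> max N M" "k \<ge> max N M" for j k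
  proof -
    have "sq (x j - x k) < e / 4" "sq (y j - y k) < e / 4"
      using N M that by auto
    then show ?thesis
      using sq_add_le[of "x j - x k" "y j - y k"] by (simp add: algebra_simps)
  qed
  then show "\<exists>N. \<forall>j\<ge>N. \<forall>k\<ge>N. sq (x j + y j - (x k + y k)) < e" by blast
qed

lemma form_Cauchy_scale:
  assumes "form_Cauchy y"
  shows "form_Cauchy (\<lambda>k. scale c (y k))"
  unfolding form_Cauchy_def
proof (intro allI impI)
  fix e :: real assume "0 < e"
  \<comment> \<open>Adding 1 keeps the divisor positive also for \<open>c = 0\<close>.\<close>
  have pos: "0 < (cmod c)\<^sup>2 + 1" by (simp add: add_nonneg_pos)
  with \<open>0 < e\<close> have "0 < e / ((cmod c)\<^sup>2 + 1)" by simp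
  with assms obtain N where N: "\<forall>j\<ge>N. \<forall>k\<ge>N. sq (y j - y k) < e / ((cmod c)\<^sup>2 + 1)"
    unfolding form_Cauchy_def by metis
  have "sq (scale c (y j) - scale c (y k)) < e" if "j \<ge> N" "k \<ge> N" for j k
  proof -
    have "((cmod c)\<^sup>2 + 1) * sq (y j - y k) < e"
      using N that pos by (simp add: field_simps)
    moreover have "sq (scale c (y j) - scale c (y k)) = (cmod c)\<^sup>2 * sq (y j - y k)"
      by (simp add: scale_right_diff_distrib[symmetric] sq_scale)
    ultimately show ?thesis using sq_nonneg[of "y j - y k"]
      by (simp add: algebra_simps del: sq_nonneg)
  qed
  then show "\<exists>N. \<forall>j\<ge>N. \<forall>k\<ge>N. sq (scale c (y j) - scale c (y k)) < e" by blast
qed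

text \<open>The limit of a weakly null Cauchy sequence in the completion is orthogonal to a dense
  subspace, hence zero.\<close>

lemma form_Cauchy_weakly_null:
  assumes "form_Cauchy u" and weak: "\<And>z. (\<lambda>k. q (u k) z) \<longlonglongrightarrow> 0"
  shows "(\<lambda>k. sq (u k)) \<longlonglongrightarrow> 0"
proof (rule LIMSEQ_I)
  fix e :: real assume "0 < e"
  then have "0 < e / 2" by simp
  with assms(1) obtain N where N: "\<forall>j\<ge>N. \<forall>k\<ge>N. sq (u j - u k) < e / 2"
    unfolding form_Cauchy_def by metis
  have "(\<lambda>k. Re (q (u k) (u N))) \<longlonglongrightarrow> 0"
    using tendsto_Re[OF weak] by simp
  then obtain M where M: "\<And>k. k \<ge> M \<Longrightarrow> \<bar>Re (q (u k) (u N))\<bar> < e / 4"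
    using LIMSEQ_D[of _ 0 "e / 4"] \<open>0 < e\<close> by fastforce
  have "norm (sq (u k) - 0) < e" if "k \<ge> max N M" for k
  proof -
    \<comment> \<open>Compare with the fixed vector \<open>u N\<close>: the first term is small by
      the Cauchy property, the second by weak nullity, and the third has the right sign.\<close>
    have "sq (u k) = sq (u k - u N) + 2 * Re (q (u k) (u N)) - sq (u N)"
      by (simp add: sq_diff)
    moreover have "sq (u k - u N) < e / 2" using N that by simp
    moreover have "\<bar>Re (q (u k) (u N))\<bar> < e / 4" using M that by simp
    ultimately have "sq (u k) < e" using sq_nonneg[of "u N"] by linarith
    then show ?thesis by simp
  qed
  then show "\<exists>K. \<forall>k\<ge>K. norm (sq (u k) - 0) < e" by blast
qed

text \<open>A version of the Riesz representation theorem without completeness: the minimizing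
  sequence of the associated quadratic functional takes the role of the representing vector.\<close>

lemma Riesz_sequence:
  assumes phi_add: "\<And>x y. \<phi> (x + y) = \<phi> x + \<phi> y"
    and phi_scale: "\<And>c x. \<phi> (scale c x) = cnj c * \<phi> x"
    and bound: "\<And>x. (cmod (\<phi> x))\<^sup>2 \<le> K * sq x" and "0 \<le> K"
  obtains y m where "\<And>w. m \<le> sq w - 2 * Re (\<phi> w)"
    and "(\<lambda>k. sq (y k) - 2 * Re (\<phi> (y k))) \<longlonglongrightarrow> m"
    and "form_Cauchy y"
    and "\<And>w. (\<lambda>k. q (y k) w) \<longlonglongrightarrow> \<phi> w"
    and "(\<lambda>k. \<phi> (y k)) \<longlonglongrightarrow> - of_real m"
proof -
  \<comment> \<open>The functional whose stationarity condition is \<open>q y w = \<phi> w\<close>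
    for all \<open>w\<close>.\<close>
  define J where "J w = sq w - 2 * Re (\<phi> w)" for w
  have coercive: "sq w / 2 - 2 * K \<le> J w" for w
  proof -
    \<comment> \<open>The bound on \<open>\<phi>\<close> reduces this to
      \<open>(sq w / 2 - 2 * K)^2 \<ge> 0\<close>.\<close>
    have "(2 * cmod (\<phi> w))\<^sup>2 \<le> (sq w / 2 + 2 * K)\<^sup>2"
      using bound[of w] sum_squares_ge_zero[of "sq w / 2 - 2 * K" 0]
      by (simp add: power2_eq_square algebra_simps)
    then have "2 * cmod (\<phi> w) \<le> sq w / 2 + 2 * K"
      by (rule power2_le_imp_le) (simp add: \<open>0 \<le> K\<close>)
    then show ?thesis using complex_Re_le_cmod[of "\<phi> w"] by (simp add: J_def)
  qed
  then have bdd: "bdd_below (range J)"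
    by (intro bdd_belowI2[of _ "- 2 * K"]) (smt (verit) sq_nonneg field_sum_of_halves)
  define m where "m = (INF w. J w)"
  have m_le: "m \<le> J w" for w
    unfolding m_def using bdd by (intro cINF_lower) auto
  have "\<exists>w. J w < m + 1 / Suc k" for k :: nat
    using cINF_less_iff[of UNIV J "m + 1 / Suc k"] bdd by (auto simp: m_def)
  then obtain y where y: "\<And>k. J (y k) < m + 1 / Suc k" by metis
  define d where "d k = J (y k) - m" for k
  have d: "0 \<le> d k" "d k < 1 / Suc k" for k
    using m_le[of "y k"] y[of k] by (auto simp: d_def)
  have d_lim: "d \<longlonglongrightarrow> 0"
    by (rule tendsto_sandwich[OF _ _ tendsto_const LIMSEQ_inverse_real_of_nat])
      (use d in \<open>auto intro!: always_eventually less_imp_le simp: inverse_eq_divide\<close>)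
  have J_lim: "(\<lambda>k. J (y k)) \<longlonglongrightarrow> m"
    using tendsto_add[OF d_lim tendsto_const[of m]] by (simp add: d_def)
  \<comment> \<open>\<open>J\<close> is at least \<open>m\<close> at the midpoint of
    \<open>y j\<close> and \<open>y k\<close>; the parallelogram law turns this into a bound on
    their distance.\<close>
  have cauchy_est: "sq (y j - y k) \<le> 2 * d j + 2 * d k" for j k
  proof -
    have "4 * m \<le> 4 * J (scale (1/2) (y j + y k))" using m_le by simp
    also have "\<dots> = sq (y j + y k) - 4 * Re (\<phi> (y j)) - 4 * Re (\<phi> (y k))"
      using sq_midpoint[of "y j" "y k"] by (simp add: J_def phi_add phi_scale field_simps)
    finally show ?thesis
      using parallelogram[of "y j" "y k"] by (simp add: d_def J_def)
  qed
  have cauchy: "form_Cauchy y"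
    unfolding form_Cauchy_def
  proof (intro allI impI)
    fix e :: real assume "0 < e"
    then obtain N where N: "\<And>k. k \<ge> N \<Longrightarrow> norm (d k - 0) < e / 4"
      using LIMSEQ_D[OF d_lim, of "e / 4"] by auto
    have "sq (y j - y k) < e" if "j \<ge> N" "k \<ge> N" for j k
      using cauchy_est[of j k] N[OF that(1)] N[OF that(2)] d(1)[of j] d(1)[of k] by simp
    then show "\<exists>N. \<forall>j\<ge>N. \<forall>k\<ge>N. sq (y j - y k) < e" by blast
  qed
  \<comment> \<open>Approximate stationarity: moving \<open>y k\<close> by a multiple of
    \<open>w\<close> lowers \<open>J\<close> by at most \<open>d k\<close>. Taking
    \<open>t = 1 / (sq w + 1)\<close> instead of the optimal \<open>1 / sq w\<close> also covers
    \<open>sq w = 0\<close>.\<close>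
  have euler: "(cmod (q (y k) w - \<phi> w))\<^sup>2 \<le> d k * (sq w + 1)" for k w
  proof -
    define r where "r = q (y k) w - \<phi> w"
    define t where "t = 1 / (sq w + 1)"
    have pos: "0 < sq w + 1" using sq_nonneg[of w] by linarith
    define v where "v = scale (- of_real t * r) w"
    have "q (y k) v - \<phi> v = cnj (- of_real t * r) * (q (y k) w - \<phi> w)"
      by (simp only: v_def scale_right phi_scale right_diff_distrib)
    also have "\<dots> = - of_real t * (r * cnj r)"
      unfolding r_def[symmetric] by simp
    also have "\<dots> = of_real (- t * (cmod r)\<^sup>2)"
      by (simp only: complex_norm_square[symmetric] of_real_mult of_real_minus)
    finally have "Re (q (y k) v) - Re (\<phi> v) = - t * (cmod r)\<^sup>2"
      by (metis Re_complex_of_real minus_complex.sel(1))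
    moreover have "m \<le> J (y k + v)" by (rule m_le)
    moreover have "sq v = t\<^sup>2 * (cmod r)\<^sup>2 * sq w"
      unfolding v_def sq_scale by (simp add: norm_mult power_mult_distrib)
    ultimately have "0 \<le> d k - 2 * t * (cmod r)\<^sup>2 + t\<^sup>2 * (cmod r)\<^sup>2 * sq w"
      by (simp add: J_def d_def sq_add phi_add)
    moreover have "t\<^sup>2 * (cmod r)\<^sup>2 * sq w \<le> t * (cmod r)\<^sup>2"
    proof -
      have "t * (t * sq w) \<le> t * 1"
        using pos by (intro mult_left_mono) (auto simp: t_def field_simps)
      then have "t * (t * sq w) * (cmod r)\<^sup>2 \<le> t * 1 * (cmod r)\<^sup>2"
        by (rule mult_right_mono) simp
      then show ?thesis by (simp add: power2_eq_square algebra_simps)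
    qed
    ultimately have "t * (cmod r)\<^sup>2 \<le> d k" by linarith
    then show ?thesis using pos by (simp add: t_def r_def field_simps)
  qed
  \<comment> \<open>The estimate is uniform on bounded sets, so the test vector may vary with
    \<open>k\<close>. It is used for a constant vector and for \<open>y k\<close> itself.\<close>
  have null: "(\<lambda>k. q (y k) (w k) - \<phi> (w k)) \<longlonglongrightarrow> 0" if "\<And>k. sq (w k) \<le> C" for w C
  proof -
    have "(\<lambda>k. sqrt (d k * (C + 1))) \<longlonglongrightarrow> sqrt (0 * (C + 1))"
      by (intro tendsto_intros d_lim)
    then have "(\<lambda>k. sqrt (d k * (C + 1))) \<longlonglongrightarrow> 0"
      by (simp only: mult_zero_left real_sqrt_zero)
    moreover have "cmod (q (y k) (w k) - \<phi> (w k)) \<le> sqrt (d k * (C + 1))" for k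
    proof (rule real_le_rsqrt)
      have "d k * (sq (w k) + 1) \<le> d k * (C + 1)"
        using that d by (intro mult_left_mono) auto
      then show "(cmod (q (y k) (w k) - \<phi> (w k)))\<^sup>2 \<le> d k * (C + 1)"
        using euler[of k "w k"] by linarith
    qed
    then have "\<forall>\<^sub>F k in sequentially. cmod (q (y k) (w k) - \<phi> (w k)) \<le> sqrt (d k * (C + 1))"
      by (rule always_eventually[OF allI])
    ultimately show ?thesis by (rule Lim_null_comparison[rotated])
  qed
  have weak: "(\<lambda>k. q (y k) w) \<longlonglongrightarrow> \<phi> w" for w
    using null[of "\<lambda>_. w" "sq w"] by (simp add: LIM_zero_iff)
  have "sq (y k) \<le> 2 * (m + 1) + 4 * K" for k
  proof -
    have "1 / real (Suc k) \<le> 1" by simp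
    then show ?thesis using coercive[of "y k"] y[of k] by argo
  qed
  then have "(\<lambda>k. q (y k) (y k) - \<phi> (y k)) \<longlonglongrightarrow> 0" by (rule null)
  then have r: "(\<lambda>k. of_real (sq (y k)) - \<phi> (y k)) \<longlonglongrightarrow> 0"
    by (simp add: self_eq)
  \<comment> \<open>The terms \<open>sq (y k)\<close> cancel and leave
    \<open>Re (\<phi> (y k))\<close>.\<close>
  have "(\<lambda>k. Re (of_real (sq (y k)) - \<phi> (y k)) - J (y k)) \<longlonglongrightarrow> Re 0 - m"
    by (intro tendsto_diff tendsto_Re r J_lim)
  then have "(\<lambda>k. Re (\<phi> (y k))) \<longlonglongrightarrow> - m" by (simp add: J_def)
  moreover have "(\<lambda>k. Im (\<phi> (y k))) \<longlonglongrightarrow> 0"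
    using tendsto_minus[OF tendsto_Im[OF r]] by simp
  ultimately have "(\<lambda>k. \<phi> (y k)) \<longlonglongrightarrow> - of_real m"
    by (simp add: tendsto_complex_iff)
  with that[of m y] m_le J_lim cauchy weak show ?thesis by (simp add: J_def)
qed

end


section \<open>Anti-dual pairs\<close>

context anti_dual_pair
begin

section \<open>Weak topologies and weak-* sequential completeness\<close>

lemma pr_diff_left: "pr (f - g) z = pr f z - pr g z"
  using pr_add_left[of "f - g" g z] by simp

text \<open>Induction on the generation of the neighbourhood of 0; for a subbasic set the claim is
  the Cauchy property of one scalar sequence, as the pairing is additive on the left.\<close>

lemma Cauchy_seq_in_sigma_FE:
  assumes "\<And>z. Cauchy (\<lambda>k. pr (s k) z)"
  shows "Cauchy_seq_in (sigma_FE pr) s"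
  unfolding Cauchy_seq_in_def
proof (intro allI impI, elim conjE)
  fix U assume "openin (sigma_FE pr) U" and "0 \<in> U"
  then have "generate_topology_on {\<phi> -` V | \<phi> V. \<phi> \<in> range (\<lambda>x f. pr f x) \<and> open V} U"
    by (simp add: sigma_FE_def weak_topology_def openin_topology_generated_by_iff)
  then show "\<exists>N. \<forall>m\<ge>N. \<forall>n\<ge>N. s m - s n \<in> U" using \<open>0 \<in> U\<close>
  proof (induction U rule: generate_topology_on.induct)
    case Empty
    then show ?case by simp
  next
    case (Int S T)
    then obtain M N where "\<forall>m\<ge>M. \<forall>n\<ge>M. s m - s n \<in> S" "\<forall>m\<ge>N. \<forall>n\<ge>N. s m - s n \<in> T"
      by auto
    then have "\<forall>m\<ge>max M N. \<forall>n\<ge>max M N. s m - s n \<in> S \<inter> T" by auto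
    then show ?case by blast
  next
    case (UN K)
    then show ?case by (meson UnionE UnionI)
  next
    case (Basis S)
    then obtain z V where S: "S = (\<lambda>f. pr f z) -` V" and "open V" by auto
    have "0 \<in> V" using Basis(2) pr_diff_left[of 0 0 z] by (simp add: S)
    with \<open>open V\<close> obtain e where "0 < e" and e: "ball 0 e \<subseteq> V"
      by (meson open_contains_ball)
    obtain N where "\<forall>m\<ge>N. \<forall>n\<ge>N. dist (pr (s m) z) (pr (s n) z) < e"
      using assms \<open>0 < e\<close> unfolding Cauchy_def by metis
    then have "\<forall>m\<ge>N. \<forall>n\<ge>N. pr (s m) z - pr (s n) z \<in> ball 0 e" by (simp add: dist_norm)
    then have "\<forall>m\<ge>N. \<forall>n\<ge>N. pr (s m) z - pr (s n) z \<in> V" using e by blast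
    then show ?case by (auto simp: S pr_diff_left)
  qed
qed

lemma limitin_sigma_FE_D:
  assumes "limitin (sigma_FE pr) s l sequentially"
  shows "(\<lambda>k. pr (s k) z) \<longlonglongrightarrow> pr l z"
proof (rule topological_tendstoI)
  fix V :: "complex set" assume "open V" "pr l z \<in> V"
  have "openin (sigma_FE pr) ((\<lambda>f. pr f z) -` V)"
    unfolding sigma_FE_def weak_topology_def
    by (rule topology_generated_by_Basis) (use \<open>open V\<close> in blast)
  then show "\<forall>\<^sub>F k in sequentially. pr (s k) z \<in> V"
    using assms \<open>pr l z \<in> V\<close> by (auto simp: limitin_def)
qed

text \<open>The form in which completeness enters the construction of the parallel sum.\<close>

lemma weak_star_limit:
  assumes "weak_star_seq_complete pr" and "\<And>z. Cauchy (\<lambda>k. pr (s k) z)"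
  obtains l where "\<And>z. (\<lambda>k. pr (s k) z) \<longlonglongrightarrow> pr l z"
  using assms Cauchy_seq_in_sigma_FE limitin_sigma_FE_D
  unfolding weak_star_seq_complete_def by metis

section \<open>Positive operators: associated forms, weak continuity, order\<close>

lemma linear_ops_iff:
  "Vector_Spaces.linear sE sF T \<longleftrightarrow>
    (\<forall>x y. T (x + y) = T x + T y) \<and> (\<forall>c x. T (sE c x) = sF c (T x))"
  using E.vector_space_axioms F.vector_space_axioms
  by (auto simp: Vector_Spaces.linear_iff vector_space_pair_def)

lemma positive_form_operator:
  assumes "positive_operator sE sF pr T"
  shows "positive_form sE (\<lambda>x y. pr (T x) y)"
  using assms unfolding positive_operator_def linear_ops_iff
  by unfold_locales (simp_all add: pr_add_left pr_add_right pr_scale_left pr_scale_right)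

lemma positive_operatorI:
  assumes "\<And>x y. T (x + y) = T x + T y" "\<And>c x. T (sE c x) = sF c (T x)"
    and "\<And>x. pr (T x) x \<in> \<real>\<^sub>\<ge>\<^sub>0"
  shows "positive_operator sE sF pr T"
  using assms by (simp add: positive_operator_def linear_ops_iff)

lemma pr_eqI: "(\<And>z. pr f z = pr g z) \<Longrightarrow> f = g"
  using separates_F by blast

text \<open>By hermitian symmetry, \<open>pr (T x) z\<close> is the conjugate of
  \<open>pr (T z) x\<close>, a weakly continuous function of \<open>x\<close>; so preimages of
  subbasic sets are subbasic.\<close>

lemma positive_weakly_continuous:
  assumes "positive_operator sE sF pr T"
  shows "T \<in> weakly_continuous_operators sE sF pr"
proof -
  interpret T: positive_form sE "\<lambda>x y. pr (T x) y"
    by (rule positive_form_operator[OF assms])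
  have "continuous_map (sigma_EF pr) (sigma_FE pr) T"
    unfolding sigma_FE_def weak_topology_def
  proof (rule continuous_on_generated_topo)
    fix U assume "U \<in> {\<phi> -` V | \<phi> V. \<phi> \<in> range (\<lambda>x f. pr f x) \<and> open V}"
    then obtain z V where U: "U = (\<lambda>f. pr f z) -` V" and V: "open V" by auto
    have "pr (T x) z = cnj (pr (T z) x)" for x by (rule T.hermitian)
    then have eq: "T -` U = (\<lambda>x. pr (T z) x) -` (cnj -` V)" by (auto simp: U)
    have "open (cnj -` V)"
      by (rule open_vimage[OF V]) (intro continuous_intros)
    then have "openin (sigma_EF pr) (T -` U)"
      unfolding eq sigma_EF_def weak_topology_def
      by (intro topology_generated_by_Basis) blast
    then show "openin (sigma_EF pr) (T -` U \<inter> topspace (sigma_EF pr))" by blast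
  next
    have "UNIV \<in> {\<phi> -` V | \<phi> V. \<phi> \<in> range (\<lambda>x f. pr f x) \<and> open V}"
      by (force intro: exI[of _ "UNIV :: complex set"])
    then show "T ` topspace (sigma_EF pr) \<subseteq> \<Union> {\<phi> -` V | \<phi> V. \<phi> \<in> range (\<lambda>x f. pr f x) \<and> open V}"
      by blast
  qed
  then show ?thesis
    using assms by (simp add: weakly_continuous_operators_def positive_operator_def)
qed

text \<open>The difference of linear operators is linear and both diagonals are real, so the order
  only compares quadratic forms.\<close>

lemma operator_le_iff:
  assumes "positive_operator sE sF pr S" "positive_operator sE sF pr T"
  shows "operator_le sE sF pr S T \<longleftrightarrow> (\<forall>x. Re (pr (S x) x) \<le> Re (pr (T x) x))"
proof -
  interpret S: positive_form sE "\<lambda>x y. pr (S x) y" by (rule positive_form_operator[OF assms(1)])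
  interpret T: positive_form sE "\<lambda>x y. pr (T x) y" by (rule positive_form_operator[OF assms(2)])
  have "Vector_Spaces.linear sE sF (\<lambda>x. T x - S x)"
    using assms unfolding positive_operator_def linear_ops_iff
    by (auto simp: algebra_simps F.scale_right_diff_distrib)
  then show ?thesis
    by (simp add: operator_le_def positive_operator_def pr_diff_left complex_nonneg_Reals_iff
        S.self_eq T.self_eq)
qed

text \<open>The parallel sum of \<open>B\<close> and \<open>A\<close>: with \<open>y\<close> a Riesz sequence of \<open>pr (B x)\<close> for the form
  of \<open>B + A\<close>, its value at \<open>x\<close> is the weak-* limit of \<open>B (x - y k)\<close>. Attaching all such
  sequences to \<open>x\<close> yields a linear relation, which makes linearity of the operator immediate.\<close>

lemma parallel_sum_exists:
  assumes complete: "weak_star_seq_complete pr"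
    and A: "positive_operator sE sF pr A" and B: "positive_operator sE sF pr B"
  obtains S where "positive_operator sE sF pr S"
    and "\<And>x w. Re (pr (S x) x) \<le> Re (pr (B (x - w)) (x - w)) + Re (pr (A w) w)"
    and "\<And>x e. 0 < e \<Longrightarrow> \<exists>w. Re (pr (B (x - w)) (x - w)) + Re (pr (A w) w) < Re (pr (S x) x) + e"
proof -
  interpret A: positive_form sE "\<lambda>x y. pr (A x) y" by (rule positive_form_operator[OF A])
  interpret B: positive_form sE "\<lambda>x y. pr (B x) y" by (rule positive_form_operator[OF B])
  interpret C: positive_form sE "\<lambda>x y. pr (B x) y + pr (A x) y"
    by unfold_locales
      (simp_all add: A.add_left B.add_left A.add_right B.add_right A.scale_left B.scale_left
        A.scale_right B.scale_right algebra_simps A.nonneg B.nonneg nonneg_Reals_add_I)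
  have sq_C: "C.sq w = B.sq w + A.sq w" for w by (simp add: A.sq_def B.sq_def C.sq_def)
  \<comment> \<open>Weakly null Cauchy sequences for \<open>B + A\<close> are null in its seminorm,
    hence in the smaller one of \<open>B\<close>. This makes the relation \<open>R\<close> below
    single-valued.\<close>
  have B_null: "(\<lambda>k. pr (B (u k)) z) \<longlonglongrightarrow> 0"
    if "C.form_Cauchy u" "\<And>z. (\<lambda>k. pr (B (u k)) z + pr (A (u k)) z) \<longlonglongrightarrow> 0" for u z
  proof (rule B.tendsto_form_zero)
    show "(\<lambda>k. B.sq (u k)) \<longlonglongrightarrow> 0"
      by (rule tendsto_sandwich[OF _ _ tendsto_const C.form_Cauchy_weakly_null[OF that]])
        (auto simp: sq_C)
  qed
  define R where "R x f \<longleftrightarrow> (\<exists>y. C.form_Cauchy y \<and>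
      (\<forall>z. (\<lambda>k. pr (B (y k)) z + pr (A (y k)) z) \<longlonglongrightarrow> pr (B x) z) \<and>
      (\<forall>z. (\<lambda>k. pr (B x) z - pr (B (y k)) z) \<longlonglongrightarrow> pr f z))" for x f
  have R_add: "R (x + x') (f + f')" if xf: "R x f" "R x' f'" for x x' f f'
  proof -
    from xf(1) obtain y where y: "C.form_Cauchy y"
      "\<And>z. (\<lambda>k. pr (B (y k)) z + pr (A (y k)) z) \<longlonglongrightarrow> pr (B x) z"
      "\<And>z. (\<lambda>k. pr (B x) z - pr (B (y k)) z) \<longlonglongrightarrow> pr f z" unfolding R_def by blast
    from xf(2) obtain y' where y': "C.form_Cauchy y'"
      "\<And>z. (\<lambda>k. pr (B (y' k)) z + pr (A (y' k)) z) \<longlonglongrightarrow> pr (B x') z"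
      "\<And>z. (\<lambda>k. pr (B x') z - pr (B (y' k)) z) \<longlonglongrightarrow> pr f' z" unfolding R_def by blast
    have "(\<lambda>k. pr (B (y k + y' k)) z + pr (A (y k + y' k)) z) \<longlonglongrightarrow> pr (B (x + x')) z"
      "(\<lambda>k. pr (B (x + x')) z - pr (B (y k + y' k)) z) \<longlonglongrightarrow> pr (f + f') z" for z
      using tendsto_add[OF y(2) y'(2), of z z] tendsto_add[OF y(3) y'(3), of z z]
      by (simp_all add: A.add_left B.add_left pr_add_left algebra_simps)
    with C.form_Cauchy_add[OF y(1) y'(1)] show ?thesis
      unfolding R_def by (intro exI[of _ "\<lambda>k. y k + y' k"]) blast
  qed
  have R_scale: "R (sE c x) (sF c f)" if xf: "R x f" for c x f
  proof -
    from xf obtain y where y: "C.form_Cauchy y"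
      "\<And>z. (\<lambda>k. pr (B (y k)) z + pr (A (y k)) z) \<longlonglongrightarrow> pr (B x) z"
      "\<And>z. (\<lambda>k. pr (B x) z - pr (B (y k)) z) \<longlonglongrightarrow> pr f z" unfolding R_def by blast
    have "(\<lambda>k. pr (B (sE c (y k))) z + pr (A (sE c (y k))) z) \<longlonglongrightarrow> pr (B (sE c x)) z"
      "(\<lambda>k. pr (B (sE c x)) z - pr (B (sE c (y k))) z) \<longlonglongrightarrow> pr (sF c f) z" for z
      using tendsto_mult_left[OF y(2), of c z] tendsto_mult_left[OF y(3), of c z]
      by (simp_all add: A.scale_left B.scale_left pr_scale_left algebra_simps)
    with C.form_Cauchy_scale[OF y(1)] show ?thesis
      unfolding R_def by (intro exI[of _ "\<lambda>k. sE c (y k)"]) blast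
  qed
  \<comment> \<open>A sequence attached to 0 is weakly null for \<open>B + A\<close>.\<close>
  have R_zero: "f = 0" if "R 0 f" for f
  proof (rule pr_eqI)
    fix z
    have B0: "pr (B 0) w = 0" for w using B.diff_left[of 0 0 w] by simp
    from \<open>R 0 f\<close> obtain y where y: "C.form_Cauchy y"
      "\<And>z. (\<lambda>k. pr (B (y k)) z + pr (A (y k)) z) \<longlonglongrightarrow> 0"
      "\<And>z. (\<lambda>k. 0 - pr (B (y k)) z) \<longlonglongrightarrow> pr f z" unfolding R_def B0 by blast
    have "pr f z = 0"
      using LIMSEQ_unique[OF y(3) tendsto_diff[OF tendsto_const B_null[OF y(1,2)]]] by simp
    then show "pr f z = pr 0 z" using pr_diff_left[of 0 0 z] by simp
  qed
  have R_unique: "f = g" if "R x f" "R x g" for x f g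
  proof -
    have "R (x + sE (-1) x) (f + sF (-1) g)" by (intro R_add R_scale that)
    then show ?thesis using R_zero[of "f - g"] by simp
  qed
  \<comment> \<open>Here \<open>m\<close> is the infimum of the Riesz functional of
    \<open>pr (B x)\<close>. By \<open>split\<close> below, \<open>B.sq x + m\<close> is the infimum
    of \<open>B.sq (x - w) + A.sq w\<close>.\<close>
  define P where "P x f m \<longleftrightarrow> pr f x = of_real (B.sq x + m) \<and>
      (\<forall>w. m \<le> C.sq w - 2 * Re (pr (B x) w)) \<and>
      (\<forall>e>0. \<exists>w. C.sq w - 2 * Re (pr (B x) w) < m + e)" for x f m
  have "\<exists>f m. R x f \<and> P x f m" for x
  proof -
    have bound: "(cmod (pr (B x) w))\<^sup>2 \<le> B.sq x * C.sq w" for w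
      by (rule order_trans[OF B.Cauchy_Schwarz]) (simp add: sq_C mult_left_mono)
    obtain y m where m: "\<And>w. m \<le> C.sq w - 2 * Re (pr (B x) w)"
      and lim: "(\<lambda>k. C.sq (y k) - 2 * Re (pr (B x) (y k))) \<longlonglongrightarrow> m"
      and y: "C.form_Cauchy y"
      and weak: "\<And>w. (\<lambda>k. pr (B (y k)) w + pr (A (y k)) w) \<longlonglongrightarrow> pr (B x) w"
      and val: "(\<lambda>k. pr (B x) (y k)) \<longlonglongrightarrow> - of_real m"
      by (rule C.Riesz_sequence[of "pr (B x)" "B.sq x", OF B.add_right B.scale_right bound B.sq_nonneg])
        (rule that)
    have "Cauchy (\<lambda>k. pr (B (x - y k)) z)" for z
    proof (rule metric_CauchyI)
      fix e :: real assume "0 < e"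
      have pos: "0 < B.sq z + 1" using B.sq_nonneg[of z] by linarith
      with \<open>0 < e\<close> have "0 < e\<^sup>2 / (B.sq z + 1)" by simp
      with y obtain N where
        N: "\<And>j k. j \<ge> N \<Longrightarrow> k \<ge> N \<Longrightarrow> C.sq (y j - y k) < e\<^sup>2 / (B.sq z + 1)"
        unfolding C.form_Cauchy_def by blast
      have "dist (pr (B (x - y k)) z) (pr (B (x - y j)) z) < e" if "k \<ge> N" "j \<ge> N" for j k
      proof -
        have "(cmod (pr (B (y j - y k)) z))\<^sup>2 \<le> B.sq (y j - y k) * B.sq z"
          by (rule B.Cauchy_Schwarz)
        also have "\<dots> \<le> C.sq (y j - y k) * (B.sq z + 1)"
          by (intro mult_mono) (auto simp: sq_C)
        also have "\<dots> < e\<^sup>2" using N[OF that(2,1)] pos by (simp add: field_simps)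
        finally have "cmod (pr (B (y j - y k)) z) < e"
          using \<open>0 < e\<close> by (meson less_imp_le power2_less_imp_less)
        then show ?thesis by (simp add: dist_norm B.diff_left)
      qed
      then show "\<exists>N. \<forall>k\<ge>N. \<forall>j\<ge>N. dist (pr (B (x - y k)) z) (pr (B (x - y j)) z) < e" by blast
    qed
    then obtain f where f: "\<And>z. (\<lambda>k. pr (B (x - y k)) z) \<longlonglongrightarrow> pr f z"
      using weak_star_limit[OF complete, of "\<lambda>k. B (x - y k)"] by blast
    \<comment> \<open>The diagonal value comes from the limit of \<open>pr (B x) (y k)\<close>; it
      is real, so the conjugation disappears.\<close>
    have "(\<lambda>k. pr (B x) x - cnj (pr (B x) (y k))) \<longlonglongrightarrow> pr (B x) x - cnj (- of_real m)"
      by (intro tendsto_intros val)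
    moreover have "pr (B (x - y k)) x = pr (B x) x - cnj (pr (B x) (y k))" for k
      by (simp only: B.diff_left B.hermitian[of "y k" x])
    ultimately have "(\<lambda>k. pr (B (x - y k)) x) \<longlonglongrightarrow> of_real (B.sq x + m)"
      by (simp add: B.self_eq)
    then have "pr f x = of_real (B.sq x + m)" using f LIMSEQ_unique by blast
    moreover have "R x f"
      unfolding R_def using y weak f by (intro exI[of _ y]) (simp add: B.diff_left)
    moreover have "\<exists>w. C.sq w - 2 * Re (pr (B x) w) < m + e" if "0 < e" for e
      using order_tendstoD(2)[OF lim, of "m + e"] that
      by (auto dest!: eventually_happens'[OF sequentially_bot])
    ultimately show ?thesis using m unfolding P_def by blast
  qed
  then obtain S M where S: "\<And>x. R x (S x)" and "\<And>x. P x (S x) (M x)" by metis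
  then have diag: "\<And>x. pr (S x) x = of_real (B.sq x + M x)"
    and lower: "\<And>x w. M x \<le> C.sq w - 2 * Re (pr (B x) w)"
    and approx: "\<And>x e. 0 < e \<Longrightarrow> \<exists>w. C.sq w - 2 * Re (pr (B x) w) < M x + e"
    unfolding P_def by blast+
  \<comment> \<open>Completing the square turns the Riesz functional into the one defining the
    parallel sum.\<close>
  have split: "C.sq w - 2 * Re (pr (B x) w) = B.sq (x - w) + A.sq w - B.sq x" for x w
    by (simp add: sq_C B.sq_diff)
  have "0 \<le> B.sq x + M x" for x
  proof (rule field_le_epsilon)
    fix e :: real assume "0 < e"
    from approx[OF this] obtain w where "B.sq (x - w) + A.sq w - B.sq x < M x + e"
      unfolding split by blast
    then show "0 \<le> B.sq x + M x + e"
      using A.sq_nonneg[of w] B.sq_nonneg[of "x - w"] by linarith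
  qed
  then have "positive_operator sE sF pr S"
    by (intro positive_operatorI)
      (auto simp: diag intro: R_unique[OF S R_add] R_unique[OF S R_scale] S simp del: of_real_add)
  moreover have "Re (pr (S x) x) \<le> Re (pr (B (x - w)) (x - w)) + Re (pr (A w) w)" for x w
    using lower[of x w] unfolding split by (simp add: diag A.sq_def B.sq_def)
  moreover have "\<exists>w. Re (pr (B (x - w)) (x - w)) + Re (pr (A w) w) < Re (pr (S x) x) + e"
    if "0 < e" for x e
  proof -
    from approx[OF that] obtain w where "B.sq (x - w) + A.sq w - B.sq x < M x + e"
      unfolding split by blast
    then show ?thesis by (intro exI[of _ w]) (simp add: diag A.sq_def B.sq_def)
  qed
  ultimately show ?thesis using that by blast
qed

section \<open>The two implications of the equivalence\<close>

lemma almost_dominated_imp_absolutely_continuous: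
  assumes A: "positive_operator sE sF pr A" and B: "positive_operator sE sF pr B"
    and "almost_dominated sE sF pr B A"
  shows "absolutely_continuous_wrt pr B A"
  unfolding absolutely_continuous_wrt_def
proof (intro allI impI)
  from assms(3) obtain Bs \<alpha> where
    "\<forall>n. Bs n \<in> weakly_continuous_operators sE sF pr \<and> positive_operator sE sF pr (Bs n)"
    and mono: "\<forall>m n. m \<le> n \<longrightarrow> operator_le sE sF pr (Bs m) (Bs n)"
    and dom: "\<forall>n. operator_le sE sF pr (Bs n) (\<lambda>x. sF (of_real (\<alpha> n)) (A x))"
    and conv: "pointwise_converges pr Bs B"
    unfolding almost_dominated_def by (elim exE conjE) (rule that; assumption)
  then have pos: "positive_operator sE sF pr (Bs n)" for n by blast
  interpret A: positive_form sE "\<lambda>x y. pr (A x) y" by (rule positive_form_operator[OF A])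
  interpret B: positive_form sE "\<lambda>x y. pr (B x) y" by (rule positive_form_operator[OF B])
  define b where "b n x = Re (pr (Bs n x) x)" for n x
  have b_lim: "(\<lambda>n. b n x) \<longlonglongrightarrow> B.sq x" for x
    using conv unfolding b_def B.sq_def pointwise_converges_def by (intro tendsto_Re) blast
  have "incseq (\<lambda>n. b n x)" for x
    using mono operator_le_iff[OF pos pos] by (auto simp: incseq_def b_def)
  then have b_le: "b n x \<le> B.sq x" for n x
    using b_lim by (rule incseq_le)
  have b_dom: "b n x \<le> \<alpha> n * A.sq x" for n x
  proof -
    have "pr (sF (of_real (\<alpha> n)) (A x) - Bs n x) x \<in> \<real>\<^sub>\<ge>\<^sub>0"
      using dom by (simp add: operator_le_def positive_operator_def)
    then show ?thesis
      by (simp add: complex_nonneg_Reals_iff pr_diff_left pr_scale_left b_def A.sq_def)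
  qed
  have b_nonneg: "0 \<le> b n x" for n x
    using pos[of n] by (simp add: positive_operator_def b_def complex_nonneg_Reals_iff)
  fix x :: "nat \<Rightarrow> _"
  assume "(\<lambda>n. pr (A (x n)) (x n)) \<longlonglongrightarrow> 0"
    and cauchy: "((\<lambda>(n, m). pr (B (x n - x m)) (x n - x m)) \<longlongrightarrow> 0) (sequentially \<times>\<^sub>F sequentially)"
  then have A_null: "(\<lambda>k. A.sq (x k)) \<longlonglongrightarrow> 0"
    using tendsto_Re by (force simp: A.sq_def)
  \<comment> \<open>For fixed \<open>n\<close> only: the constants \<open>\<alpha> n\<close> may be
    unbounded.\<close>
  have b_null: "(\<lambda>k. b n (x k)) \<longlonglongrightarrow> 0" for n
  proof (rule tendsto_sandwich[OF _ _ tendsto_const])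
    show "(\<lambda>k. \<alpha> n * A.sq (x k)) \<longlonglongrightarrow> 0"
      using tendsto_mult_left[OF A_null, of "\<alpha> n"] by simp
  qed (auto simp: b_dom b_nonneg)
  have "(\<lambda>k. B.sq (x k)) \<longlonglongrightarrow> 0"
  proof (rule LIMSEQ_I)
    fix e :: real assume "0 < e"
    then have "\<forall>\<^sub>F p in sequentially \<times>\<^sub>F sequentially.
        dist (pr (B (x (fst p) - x (snd p))) (x (fst p) - x (snd p))) 0 < e / 4"
      using tendstoD[OF cauchy, of "e / 4"] by (simp add: case_prod_beta)
    then obtain N where N: "\<And>n m. n \<ge> N \<Longrightarrow> m \<ge> N \<Longrightarrow> B.sq (x n - x m) < e / 4"
      by (auto simp: eventually_prod_sequentially B.self_eq)
    \<comment> \<open>The bound \<open>e / 2 = 2 * (e / 4)\<close> arises for each fixed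
      \<open>n\<close> as \<open>l\<close> tends to infinity; it does not depend on
      \<open>n\<close>, so it survives the limit in \<open>n\<close>.\<close>
    have "B.sq (x k) \<le> e / 2" if k: "k \<ge> N" for k
    proof (rule LIMSEQ_le_const2[OF b_lim], intro exI allI impI)
      fix n :: nat
      interpret Bn: positive_form sE "\<lambda>x y. pr (Bs n x) y"
        by (rule positive_form_operator[OF pos])
      have "(\<lambda>l. 2 * (e / 4) + 2 * b n (x l)) \<longlonglongrightarrow> 2 * (e / 4) + 2 * 0"
        by (intro tendsto_intros b_null)
      moreover have "b n (x k) \<le> 2 * (e / 4) + 2 * b n (x l)" if "l \<ge> N" for l
        using Bn.sq_add_le[of "x k - x l" "x l"] b_le[of n "x k - x l"] N[OF k that]
        by (simp add: b_def Bn.sq_def)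
      ultimately show "b n (x k) \<le> e / 2"
        using LIMSEQ_le_const[of _ "2 * (e / 4) + 2 * 0" "b n (x k)"] by auto
    qed
    then have "norm (B.sq (x k) - 0) < e" if "k \<ge> N" for k
      using that \<open>0 < e\<close> by fastforce
    then show "\<exists>N. \<forall>k\<ge>N. norm (B.sq (x k) - 0) < e" by blast
  qed
  then show "(\<lambda>n. pr (B (x n)) (x n)) \<longlonglongrightarrow> 0"
    using tendsto_of_real[of "\<lambda>k. B.sq (x k)" 0] by (simp add: B.self_eq)
qed

lemma absolutely_continuous_imp_almost_dominated:
  assumes complete: "weak_star_seq_complete pr"
    and A: "positive_operator sE sF pr A" and B: "positive_operator sE sF pr B"
    and ac: "absolutely_continuous_wrt pr B A"
  shows "almost_dominated sE sF pr B A"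
proof -
  interpret A: positive_form sE "\<lambda>x y. pr (A x) y" by (rule positive_form_operator[OF A])
  interpret B: positive_form sE "\<lambda>x y. pr (B x) y" by (rule positive_form_operator[OF B])
  define A' where "A' n x = sF (of_real (real (Suc n))) (A x)" for n x
  have A'_form: "pr (A' n x) y = of_real (real (Suc n)) * pr (A x) y" for n x y
    by (simp only: A'_def pr_scale_left)
  have A': "positive_operator sE sF pr (A' n)" for n
  proof (rule positive_operatorI)
    show "A' n (x + y) = A' n x + A' n y" for x y
      by (rule pr_eqI) (simp add: A'_form pr_add_left A.add_left distrib_left del: of_nat_Suc)
    show "A' n (sE c x) = sF c (A' n x)" for c x
      by (rule pr_eqI) (simp add: A'_form pr_scale_left A.scale_left del: of_nat_Suc)
    show "pr (A' n x) x \<in> \<real>\<^sub>\<ge>\<^sub>0" for x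
      unfolding A'_form by (intro nonneg_Reals_mult_I A.nonneg) simp
  qed
  have A'_sq: "Re (pr (A' n x) x) = real (Suc n) * A.sq x" for n x
    unfolding A'_form by (simp add: A.self_eq del: of_nat_Suc)
  have "\<exists>S. positive_operator sE sF pr S \<and>
      (\<forall>x w. Re (pr (S x) x) \<le> B.sq (x - w) + real (Suc n) * A.sq w) \<and>
      (\<forall>x e. 0 < e \<longrightarrow> (\<exists>w. B.sq (x - w) + real (Suc n) * A.sq w < Re (pr (S x) x) + e))" for n
    using parallel_sum_exists[OF complete A'[of n] B] unfolding A'_sq B.sq_def by metis
  then obtain Bs where pos: "\<And>n. positive_operator sE sF pr (Bs n)"
    and lower: "\<And>n x w. Re (pr (Bs n x) x) \<le> B.sq (x - w) + real (Suc n) * A.sq w"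
    and approx: "\<And>n x e. 0 < e \<Longrightarrow>
      \<exists>w. B.sq (x - w) + real (Suc n) * A.sq w < Re (pr (Bs n x) x) + e"
    by metis
  define b where "b n x = Re (pr (Bs n x) x)" for n x
  \<comment> \<open>The trial vectors 0 and \<open>x\<close> in the infimum give the bounds by
    \<open>B\<close> and by the multiple of \<open>A\<close>.\<close>
  have b_le: "b n x \<le> B.sq x" for n x
  proof -
    have "A.sq 0 = 0" using A.sq_scale[of 0 0] by simp
    then show ?thesis using lower[of n x 0] by (simp add: b_def)
  qed
  have b_dom: "b n x \<le> real (Suc n) * A.sq x" for n x
  proof -
    have "B.sq 0 = 0" using B.sq_scale[of 0 0] by simp
    then show ?thesis using lower[of n x x] by (simp add: b_def)
  qed
  \<comment> \<open>A near-minimizer for \<open>n\<close> is a trial vector for the smaller weight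
    \<open>Suc m\<close>.\<close>
  have b_mono: "b m x \<le> b n x" if "m \<le> n" for m n x
  proof (rule field_le_epsilon)
    fix e :: real assume "0 < e"
    then obtain w where w: "B.sq (x - w) + real (Suc n) * A.sq w < b n x + e"
      using approx unfolding b_def by blast
    have "real (Suc m) * A.sq w \<le> real (Suc n) * A.sq w"
      using that by (intro mult_right_mono) auto
    then show "b m x \<le> b n x + e"
      using lower[of m x w] w by (simp only: b_def)
  qed
  have b_nonneg: "0 \<le> b n x" for n x
    using pos[of n] by (simp add: positive_operator_def b_def complex_nonneg_Reals_iff)
  have b_lim: "(\<lambda>n. b n x) \<longlonglongrightarrow> B.sq x" for x
  proof -
    have "\<exists>w. B.sq (x - w) + real (Suc n) * A.sq w < b n x + 1 / Suc n" for n
      using approx[of "1 / Suc n" x n] by (simp add: b_def)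
    then obtain y where y: "\<And>n. B.sq (x - y n) + real (Suc n) * A.sq (y n) < b n x + 1 / Suc n"
      by metis
    have inv_lim: "(\<lambda>n. 1 / real (Suc n)) \<longlonglongrightarrow> 0"
      using LIMSEQ_inverse_real_of_nat by (simp add: inverse_eq_divide)
    \<comment> \<open>The weighted term stays below \<open>B.sq x + 1\<close>, so dividing by the
      growing weight forces \<open>A.sq (y n)\<close> to 0.\<close>
    have A_le: "A.sq (y n) \<le> (B.sq x + 1) * (1 / Suc n)" for n
    proof -
      have "1 / real (Suc n) \<le> 1" by simp
      then have "real (Suc n) * A.sq (y n) \<le> B.sq x + 1"
        using y[of n] b_le[of n x] B.sq_nonneg[of "x - y n"] by linarith
      then show ?thesis by (simp add: field_simps)
    qed
    have "(\<lambda>n. (B.sq x + 1) * (1 / real (Suc n))) \<longlonglongrightarrow> 0"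
      using tendsto_mult_left[OF inv_lim, of "B.sq x + 1"] by simp
    then have "(\<lambda>n. A.sq (y n)) \<longlonglongrightarrow> 0"
      by (rule tendsto_sandwich[OF _ _ tendsto_const, rotated 2])
        (use A_le in \<open>auto intro!: always_eventually\<close>)
    then have A_null: "(\<lambda>n. pr (A (y n)) (y n)) \<longlonglongrightarrow> 0"
      using tendsto_of_real[of "\<lambda>n. A.sq (y n)" 0] by (simp add: A.self_eq)
    \<comment> \<open>Only the existence of the limit is needed to make the differences in
      \<open>step\<close> small; its value is found at the end.\<close>
    have "incseq (\<lambda>n. b n x)" using b_mono by (simp add: incseq_def)
    then obtain l where l: "(\<lambda>n. b n x) \<longlonglongrightarrow> l"
      using incseq_convergent[of "\<lambda>n. b n x" "B.sq x"] b_le by metis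
    \<comment> \<open>The midpoint of the two near-minimizers is a trial vector for the smaller
      index \<open>m\<close>; the parallelogram law produces the distance term.\<close>
    have step: "B.sq (y n - y m) \<le> 2 * (b n x - b m x) + 2 * (1 / Suc n) + 2 * (1 / Suc m)"
      if "m \<le> n" for m n
    proof -
      define w where "w = sE (1/2) (y n + y m)"
      have "4 * b m x \<le> 4 * (B.sq (x - w) + real (Suc m) * A.sq w)"
        using lower[of m x w] by (simp add: b_def del: of_nat_Suc)
      moreover have "4 * B.sq (x - w) = 2 * B.sq (x - y n) + 2 * B.sq (x - y m) - B.sq (y n - y m)"
      proof -
        have "x = sE (1/2) x + sE (1/2) x"
          using E.scale_left_distrib[of "1/2" "1/2" x] by simp
        then have "x - w = sE (1/2) ((x - y n) + (x - y m))"
          by (simp add: w_def E.scale_right_distrib E.scale_right_diff_distrib algebra_simps)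
        then have "4 * B.sq (x - w) = B.sq ((x - y n) + (x - y m))"
          by (simp only: B.sq_midpoint)
        moreover have "B.sq ((x - y n) - (x - y m)) = B.sq (y n - y m)"
          using B.sq_scale[of "-1" "y n - y m"] by (simp add: algebra_simps)
        ultimately show ?thesis using B.parallelogram[of "x - y n" "x - y m"] by linarith
      qed
      moreover have "4 * (real (Suc m) * A.sq w) \<le> 2 * (real (Suc n) * A.sq (y n)) + 2 * (real (Suc m) * A.sq (y m))"
      proof -
        have "4 * A.sq w \<le> 2 * A.sq (y n) + 2 * A.sq (y m)"
          unfolding w_def A.sq_midpoint by (rule A.sq_add_le)
        then have "real (Suc m) * (4 * A.sq w) \<le> real (Suc m) * (2 * A.sq (y n) + 2 * A.sq (y m))"
          by (rule mult_left_mono) simp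
        \<comment> \<open>Raising the weight to \<open>Suc n\<close> matches the functional that
          \<open>y n\<close> nearly minimizes.\<close>
        moreover have "real (Suc m) * A.sq (y n) \<le> real (Suc n) * A.sq (y n)"
          using that by (intro mult_right_mono) auto
        ultimately show ?thesis by (simp add: distrib_left del: of_nat_Suc)
      qed
      ultimately show ?thesis using y[of n] y[of m] by argo
    qed
    have est: "B.sq (y n - y m) \<le> 2 * \<bar>b n x - b m x\<bar> + 2 * (1 / Suc n) + 2 * (1 / Suc m)" for n m
    proof (cases "m \<le> n")
      case True
      then show ?thesis using step[OF True] abs_ge_self[of "b n x - b m x"] by argo
    next
      case False
      have "B.sq (y m - y n) = B.sq (y n - y m)"
        using B.sq_scale[of "-1" "y n - y m"] by (simp add: algebra_simps)
      moreover have "n \<le> m" using False by simp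
      ultimately show ?thesis
        using step[of n m] abs_ge_minus_self[of "b n x - b m x"] by argo
    qed
    have "((\<lambda>p. 2 * \<bar>b (fst p) x - b (snd p) x\<bar> + 2 * (1 / Suc (fst p)) + 2 * (1 / Suc (snd p))) \<longlongrightarrow>
        2 * \<bar>l - l\<bar> + 2 * 0 + 2 * 0) (sequentially \<times>\<^sub>F sequentially)"
      by (intro tendsto_intros filterlim_compose[OF l] filterlim_compose[OF inv_lim]
          filterlim_fst filterlim_snd)
    then have est_lim: "((\<lambda>p. 2 * \<bar>b (fst p) x - b (snd p) x\<bar> + 2 * (1 / Suc (fst p)) + 2 * (1 / Suc (snd p)))
        \<longlongrightarrow> 0) (sequentially \<times>\<^sub>F sequentially)" by simp
    have "((\<lambda>p. B.sq (y (fst p) - y (snd p))) \<longlongrightarrow> 0) (sequentially \<times>\<^sub>F sequentially)"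
      by (intro tendsto_sandwich[OF _ _ tendsto_const est_lim] always_eventually allI B.sq_nonneg est)
    from tendsto_of_real[OF this, where 'a = complex]
    have "((\<lambda>(n, m). pr (B (y n - y m)) (y n - y m)) \<longlongrightarrow> 0) (sequentially \<times>\<^sub>F sequentially)"
      by (simp add: B.self_eq case_prod_unfold)
    \<comment> \<open>Absolute continuity applies: \<open>y\<close> is null for \<open>A\<close> and
      Cauchy for \<open>B\<close>.\<close>
    then have "(\<lambda>n. pr (B (y n)) (y n)) \<longlonglongrightarrow> 0"
      using ac A_null unfolding absolutely_continuous_wrt_def by blast
    then have By: "(\<lambda>n. B.sq (y n)) \<longlonglongrightarrow> 0"
      using tendsto_Re by (force simp: B.sq_def)
    have "(\<lambda>n. B.sq x - 2 * Re (pr (B (y n)) x) + B.sq (y n) - 1 / Suc n) \<longlonglongrightarrow> B.sq x - 2 * Re 0 + 0 - 0"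
      by (intro tendsto_intros B.tendsto_form_zero By inv_lim)
    then have lo: "(\<lambda>n. B.sq (x - y n) - 1 / Suc n) \<longlonglongrightarrow> B.sq x"
      by (simp add: B.sq_diff B.hermitian[of _ x])
    \<comment> \<open>Dropping the \<open>A\<close> term leaves a lower bound for
      \<open>b n x\<close> that tends to \<open>B.sq x\<close>, while \<open>b_le\<close> bounds it
      above.\<close>
    have "B.sq (x - y n) - 1 / Suc n \<le> b n x" for n
    proof -
      have "0 \<le> real (Suc n) * A.sq (y n)" by simp
      then show ?thesis using y[of n] by linarith
    qed
    then show ?thesis
      by (intro tendsto_sandwich[OF _ _ lo tendsto_const] always_eventually allI b_le)
  qed
  have "pointwise_converges pr Bs B"
    unfolding pointwise_converges_def
  proof (intro allI)
    fix x y
    have "(\<lambda>n. sqrt ((B.sq x - b n x) * (B.sq y - b n y))) \<longlonglongrightarrow>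
        sqrt ((B.sq x - B.sq x) * (B.sq y - B.sq y))"
      by (intro tendsto_intros b_lim)
    then have lim: "(\<lambda>n. sqrt ((B.sq x - b n x) * (B.sq y - b n y))) \<longlonglongrightarrow> 0" by simp
    \<comment> \<open>Cauchy-Schwarz for the positive form of \<open>B - Bs n\<close> extends
      convergence from the diagonal to all pairs.\<close>
    have "cmod (pr (B x) y - pr (Bs n x) y) \<le> sqrt ((B.sq x - b n x) * (B.sq y - b n y))" for n
    proof -
      have "operator_le sE sF pr (Bs n) B"
        using b_le by (simp add: operator_le_iff[OF pos B] b_def B.sq_def)
      then interpret D: positive_form sE "\<lambda>x y. pr (B x - Bs n x) y"
        unfolding operator_le_def by (rule positive_form_operator)
      have D_sq: "D.sq z = B.sq z - b n z" for z
        unfolding D.sq_def by (simp add: B.sq_def b_def pr_diff_left)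
      show ?thesis
        using D.Cauchy_Schwarz[of x y, unfolded D_sq, unfolded pr_diff_left]
        by (rule real_le_rsqrt)
    qed
    then have "(\<lambda>n. pr (B x) y - pr (Bs n x) y) \<longlonglongrightarrow> 0"
      by (intro Lim_null_comparison[OF _ lim] always_eventually allI)
    from tendsto_diff[OF tendsto_const[of "pr (B x) y"] this]
    show "(\<lambda>n. pr (Bs n x) y) \<longlonglongrightarrow> pr (B x) y" by simp
  qed
  moreover have "operator_le sE sF pr (Bs m) (Bs n)" if "m \<le> n" for m n
    using b_mono[OF that] by (simp add: operator_le_iff[OF pos pos] b_def)
  moreover have "operator_le sE sF pr (Bs n) (\<lambda>x. sF (of_real (real (Suc n))) (A x))" for n
  proof -
    have "operator_le sE sF pr (Bs n) (A' n)"
      using b_dom by (simp add: operator_le_iff[OF pos A'] A'_sq b_def del: of_nat_Suc)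
    moreover have "A' n = (\<lambda>x. sF (of_real (real (Suc n))) (A x))"
      by (rule ext) (rule A'_def)
    ultimately show ?thesis by simp
  qed
  ultimately show ?thesis
    unfolding almost_dominated_def
    by (intro exI[of _ Bs] exI[of _ "\<lambda>n. real (Suc n)"])
      (simp add: pos positive_weakly_continuous del: of_nat_Suc)
qed

end

theorem theorem5p1:
  fixes sE :: "complex \<Rightarrow> 'e::ab_group_add \<Rightarrow> 'e"
    and sF :: "complex \<Rightarrow> 'f::ab_group_add \<Rightarrow> 'f"
    and pr :: "'f \<Rightarrow> 'e \<Rightarrow> complex"
    and A B :: "'e \<Rightarrow> 'f"
  assumes "anti_dual_pair sE sF pr"
    and "weak_star_seq_complete pr"
    and "positive_operator sE sF pr A"
    and "positive_operator sE sF pr B"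
  shows "absolutely_continuous_wrt pr B A \<longleftrightarrow> almost_dominated sE sF pr B A"
proof -
  interpret anti_dual_pair sE sF pr by fact
  show ?thesis
    using almost_dominated_imp_absolutely_continuous[OF assms(3,4)]
      absolutely_continuous_imp_almost_dominated[OF assms(2-4)] by (rule iffI[rotated])
qed

end
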